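(* Let $M$ be a manifold of dimension $2n+1$ and let $f\colon M\rightarrow\mathbb{R}^{2n+2}$ be a nondegenerate centro-affine hypersurface with a $\widetilde{J}$-tangent centro-affine transversal vector field. Then there exist an open subset $U\subset\mathbb{R}^{2n}$, an interval $I\subset\mathbb{R}$ and an immersion $g\colon U\rightarrow\mathbb{R}^{2n+2}$ such that $f$ can be locally expressed in the form $$f(x_1,\ldots,x_{2n},z)=\widetilde{J}g(x_1,\ldots,x_{2n})\cosh z-g(x_1,\ldots,x_{2n})\sinh z$$ for all $(x_1,\ldots,x_{2n},z)\in U\times I$.
   Context: Let $n\ge 1$. $\widetilde{J}$ is the standard para-complex structure on $\mathbb{R}^{2n+2}$: $\widetilde{J}(x_1,\ldots,x_{n+1},y_1,\ldots,y_{n+1})=(y_1,\ldots,y_{n+1},x_1,\ldots,x_{n+1})$. Manifolds are connected and orientable, maps are smooth. A hypersurface is an immersion $f\colon M\to\mathbb{R}^{2n+2}$ with $\dim M=2n+1$. It is centro-affine if for each $x\in M$ the position vector $f(x)$ (from the origin) is transversal to $f_*(T_xM)$; the centro-affine transversal vector field is $C=-f$. For a transversal field $C$ the second fundamental form $h$ is defined by the Gauss formula $\mathrm{D}_Xf_*Y=f_*(\nabla_XY)+h(X,Y)C$, where $\mathrm{D}$ is the flat connection of $\mathbb{R}^{2n+2}$; $f$ is nondegenerate if $h$ is nondegenerate. A transversal vector field $C$ is $\widetilde{J}$-tangent if $\widetilde{J}C_x\in f_*(T_xM)$ for every $x\in M$. "Locally expressed" means: every point of $M$ has a neighbourhood with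 local coordinates $(x_1,\ldots,x_{2n},z)$ ranging over such a set $U\times I$ in which $f$ is given by the formula. *)

theory Defs
  imports "HOL-Analysis.Analysis"
begin

subsection \<open>Smooth maps between open sets of normed spaces\<close>

text \<open>Meant for open \<open>S\<close>. In finite dimension, \<open>f\<close> is \<open>C\<^sup>k\<^sup>+\<^sup>1\<close> iff it is differentiable and all
  its directional derivatives are \<open>C\<^sup>k\<close>; recursing through directional derivatives keeps the type
  of \<open>f\<close> fixed.\<close>

primrec Ck_on :: "nat \<Rightarrow> 'a::real_normed_vector set \<Rightarrow> ('a \<Rightarrow> 'b::real_normed_vector) \<Rightarrow> bool" where
  "Ck_on 0 S f \<longleftrightarrow> continuous_on S f"
| "Ck_on (Suc k) S f \<longleftrightarrow>
     (\<forall>x\<in>S. f differentiable (at x)) \<and> (\<forall>v. Ck_on k S (\<lambda>x. frechet_derivative f (at x) v))"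

definition smooth_on :: "'a::real_normed_vector set \<Rightarrow> ('a \<Rightarrow> 'b::real_normed_vector) \<Rightarrow> bool" where
  "smooth_on S f \<longleftrightarrow> (\<forall>k. Ck_on k S f)"

definition immersion_on :: "'a::real_normed_vector set \<Rightarrow> ('a \<Rightarrow> 'b::real_normed_vector) \<Rightarrow> bool" where
  "immersion_on S f \<longleftrightarrow> smooth_on S f \<and> (\<forall>x\<in>S. inj (frechet_derivative f (at x)))"

subsection \<open>Smooth manifolds\<close>

text \<open>A chart is a pair of its domain \<open>U\<close> and a map \<open>\<phi>\<close> of which only the values on \<open>U\<close> matter;
  its inverse is \<open>inv_into U \<phi>\<close>. The model space is an arbitrary Euclidean space.\<close>

type_synonym ('a, 'e) chart = "'a set \<times> ('a \<Rightarrow> 'e)"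

definition is_chart :: "'a topology \<Rightarrow> ('a, 'e::euclidean_space) chart \<Rightarrow> bool" where
  "is_chart M = (\<lambda>(U, \<phi>). openin M U \<and> open (\<phi> ` U) \<and>
     homeomorphic_map (subtopology M U) (top_of_set (\<phi> ` U)) \<phi>)"

definition compatible ::
  "('a, 'e::euclidean_space) chart \<Rightarrow> ('a, 'e'::euclidean_space) chart \<Rightarrow> bool" where
  "compatible = (\<lambda>(U, \<phi>) (V, \<psi>).
     smooth_on (\<phi> ` (U \<inter> V)) (\<psi> \<circ> inv_into U \<phi>) \<and>
     smooth_on (\<psi> ` (U \<inter> V)) (\<phi> \<circ> inv_into V \<psi>))"

definition smooth_atlas :: "'a topology \<Rightarrow> ('a, 'e::euclidean_space) chart set \<Rightarrow> bool" where
  "smooth_atlas M A \<longleftrightarrow>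
     (\<forall>c\<in>A. is_chart M c) \<and> (\<Union>(U, \<phi>)\<in>A. U) = topspace M \<and> (\<forall>c\<in>A. \<forall>d\<in>A. compatible c d)"

definition smooth_manifold :: "'a topology \<Rightarrow> ('a, 'e::euclidean_space) chart set \<Rightarrow> bool" where
  "smooth_manifold M A \<longleftrightarrow> Hausdorff_space M \<and> second_countable M \<and> smooth_atlas M A"

definition orientable :: "'a topology \<Rightarrow> ('a, real^'m) chart set \<Rightarrow> bool" where
  "orientable M A \<longleftrightarrow> (\<exists>B :: ('a, real^'m) chart set. smooth_atlas M B \<and> (\<forall>c\<in>A. \<forall>d\<in>B. compatible c d) \<and>
     (\<forall>(U, \<phi>)\<in>B. \<forall>(V, \<psi>)\<in>B. \<forall>p\<in>U \<inter> V.
        det (matrix (frechet_derivative (\<psi> \<circ> inv_into U \<phi>) (at (\<phi> p)))) > 0))"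

text \<open>Local coordinates on \<open>W\<close>: a chart of the maximal atlas of \<open>A\<close>, its model space being any
  Euclidean space.\<close>

definition local_coordinates ::
  "'a topology \<Rightarrow> ('a, 'e::euclidean_space) chart set \<Rightarrow> 'a set \<Rightarrow> ('a \<Rightarrow> 'e'::euclidean_space) \<Rightarrow> bool"
  where
  "local_coordinates M A W \<kappa> \<longleftrightarrow> is_chart M (W, \<kappa>) \<and> (\<forall>c\<in>A. compatible c (W, \<kappa>))"

subsection \<open>Hypersurfaces\<close>

definition immersion ::
  "('a, 'e::euclidean_space) chart set \<Rightarrow> ('a \<Rightarrow> 'v::euclidean_space) \<Rightarrow> bool" where
  "immersion A f \<longleftrightarrow> (\<forall>(U, \<phi>)\<in>A. immersion_on (\<phi> ` U) (f \<circ> inv_into U \<phi>))"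

definition hypersurface ::
  "('a, 'e::euclidean_space) chart set \<Rightarrow> ('a \<Rightarrow> 'v::euclidean_space) \<Rightarrow> bool" where
  "hypersurface A f \<longleftrightarrow> DIM('v) = DIM('e) + 1 \<and> immersion A f"

text \<open>The subspace \<open>f\<^sub>*(T\<^sub>pM)\<close>. By the chain rule every chart around \<open>p\<close> contributes the same vectors.\<close>

definition tangent_image ::
  "('a, 'e::euclidean_space) chart set \<Rightarrow> ('a \<Rightarrow> 'v::euclidean_space) \<Rightarrow> 'a \<Rightarrow> 'v set" where
  "tangent_image A f p =
     (\<Union>(U, \<phi>)\<in>{(U, \<phi>)\<in>A. p \<in> U}. range (frechet_derivative (f \<circ> inv_into U \<phi>) (at (\<phi> p))))"

definition transversal ::
  "'a topology \<Rightarrow> ('a, 'e::euclidean_space) chart set \<Rightarrow> ('a \<Rightarrow> 'v::euclidean_space) \<Rightarrow> ('a \<Rightarrow> 'v) \<Rightarrow> bool"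
  where
  "transversal M A f C \<longleftrightarrow> (\<forall>p\<in>topspace M.
     {w + s | w s. w \<in> tangent_image A f p \<and> s \<in> span {C p}} = UNIV \<and>
     tangent_image A f p \<inter> span {C p} = {0})"

definition centro_affine ::
  "'a topology \<Rightarrow> ('a, 'e::euclidean_space) chart set \<Rightarrow> ('a \<Rightarrow> 'v::euclidean_space) \<Rightarrow> bool" where
  "centro_affine M A f \<longleftrightarrow> hypersurface A f \<and> transversal M A f f"

definition centro_affine_field :: "('a \<Rightarrow> 'v::real_vector) \<Rightarrow> 'a \<Rightarrow> 'v" where
  "centro_affine_field f p = - f p"

text \<open>The Gauss formula \<open>D\<^sub>X f\<^sub>*Y = f\<^sub>*(\<nabla>\<^sub>X Y) + h(X, Y) C\<close> for vector fields on the domain of a chart.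
  Vector fields are written in the coordinates of the chart, i.e. as smooth maps from \<open>\<phi> ` U\<close> to the
  model space, and \<open>F\<close> is \<open>f\<close> in these coordinates, so that \<open>f\<^sub>*Y\<close> at \<open>q\<close> is the derivative of \<open>F\<close>
  at \<open>q\<close> in direction \<open>Y q\<close>; the value of \<open>h\<close> at the point with coordinates \<open>q\<close> is the form \<open>h q\<close>.\<close>

definition gauss_formula ::
  "('a, 'e::euclidean_space) chart \<Rightarrow> ('a \<Rightarrow> 'v::euclidean_space) \<Rightarrow> ('a \<Rightarrow> 'v) \<Rightarrow>
   (('e \<Rightarrow> 'e) \<Rightarrow> ('e \<Rightarrow> 'e) \<Rightarrow> 'e \<Rightarrow> 'e) \<Rightarrow> ('e \<Rightarrow> 'e \<Rightarrow> 'e \<Rightarrow> real) \<Rightarrow> bool" where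
  "gauss_formula = (\<lambda>(U, \<phi>) f C nabla h. let F = f \<circ> inv_into U \<phi> in
     \<forall>X Y. smooth_on (\<phi> ` U) X \<and> smooth_on (\<phi> ` U) Y \<longrightarrow>
       smooth_on (\<phi> ` U) (nabla X Y) \<and>
       (\<forall>q\<in>\<phi> ` U.
          frechet_derivative (\<lambda>r. frechet_derivative F (at r) (Y r)) (at q) (X q) =
          frechet_derivative F (at q) (nabla X Y q) + h q (X q) (Y q) *\<^sub>R C (inv_into U \<phi> q)))"

text \<open>For a transversal field \<open>C\<close> along an immersion, \<open>h\<close> is uniquely determined on \<open>\<phi> ` U\<close>.\<close>

definition second_fundamental_form ::
  "('a, 'e::euclidean_space) chart \<Rightarrow> ('a \<Rightarrow> 'v::euclidean_space) \<Rightarrow> ('a \<Rightarrow> 'v) \<Rightarrow>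
   ('e \<Rightarrow> 'e \<Rightarrow> 'e \<Rightarrow> real) \<Rightarrow> bool" where
  "second_fundamental_form c f C h \<longleftrightarrow> (\<exists>nabla. gauss_formula c f C nabla h)"

definition nondegenerate ::
  "('a, 'e::euclidean_space) chart set \<Rightarrow> ('a \<Rightarrow> 'v::euclidean_space) \<Rightarrow> ('a \<Rightarrow> 'v) \<Rightarrow> bool" where
  "nondegenerate A f C \<longleftrightarrow> (\<forall>(U, \<phi>)\<in>A. \<exists>h. second_fundamental_form (U, \<phi>) f C h \<and>
     (\<forall>q\<in>\<phi> ` U. \<forall>u. (\<forall>v. h q u v = 0) \<longrightarrow> u = 0))"

subsection \<open>The para-complex structure\<close>

text \<open>\<open>\<real>\<^sup>2\<^sup>n\<^sup>+\<^sup>2\<close> is rendered as \<open>\<real>\<^sup>n\<^sup>+\<^sup>1 \<times> \<real>\<^sup>n\<^sup>+\<^sup>1\<close>.\<close>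

definition para_J :: "(real^'k) \<times> (real^'k) \<Rightarrow> (real^'k) \<times> (real^'k)" where
  "para_J = (\<lambda>(x, y). (y, x))"

definition para_J_tangent ::
  "'a topology \<Rightarrow> ('a, 'e::euclidean_space) chart set \<Rightarrow> ('a \<Rightarrow> (real^'k) \<times> (real^'k)) \<Rightarrow>
   ('a \<Rightarrow> (real^'k) \<times> (real^'k)) \<Rightarrow> bool" where
  "para_J_tangent M A f C \<longleftrightarrow> (\<forall>p\<in>topspace M. para_J (C p) \<in> tangent_image A f p)"

end

theory Submission
  imports Defs
begin

text \<open>
  Tangency of \<open>J f\<close> says that \<open>-J f = f\<^sub>* Z\<close> for a vector field \<open>Z\<close>, so the image of \<open>f\<close> is locally
  invariant under the linear flow \<open>v \<mapsto> cosh z v - sinh z J v\<close>. No flow of \<open>Z\<close> has to be constructed: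
  since the position vector is transversal, \<open>(q, t) \<mapsto> t f q\<close> is a local diffeomorphism near
  \<open>t = 1\<close>. The curve \<open>z \<mapsto> cosh z f q - sinh z J (f q)\<close> can be written in these
  coordinates, and its \<open>t\<close>-component has derivative \<open>0\<close>, so it stays on the hypersurface. Letting \<open>q\<close> range over a hyperplane slice
  transversal to \<open>Z\<close> yields the coordinates \<open>(x, z)\<close>, with \<open>g = J f\<close> on the slice.
\<close>

subsection \<open>Calculus of smooth maps\<close>

lemma
  assumes "Ck_on (Suc k) S f"
  shows Ck_on_Suc_has_derivative: "x \<in> S \<Longrightarrow> (f has_derivative frechet_derivative f (at x)) (at x)"
    and Ck_on_Suc_derivative: "Ck_on k S (\<lambda>x. frechet_derivative f (at x) v)"
  using assms by (auto simp: frechet_derivative_works)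

text \<open>The derivatives in \<open>Ck_on\<close> are taken in the whole space, so agreement of
  \<open>f\<close> and \<open>g\<close> passes to them because the open set \<open>S\<close> is a
  neighbourhood of each of its points.\<close>

lemma Ck_on_cong:
  assumes "open S" "Ck_on k S f" "\<And>x. x \<in> S \<Longrightarrow> f x = g x"
  shows "Ck_on k S g"
  using assms(2,3)
proof (induction k arbitrary: f g)
  case 0
  then show ?case by (simp cong: continuous_on_cong)
next
  case (Suc k)
  have "(g has_derivative frechet_derivative f (at x)) (at x)" if "x \<in> S" for x
    using that Suc.prems \<open>open S\<close>
    by (metis Ck_on.simps(2) frechet_derivative_works has_derivative_transform_within_open)
  moreover from this have "frechet_derivative f (at x) v = frechet_derivative g (at x) v" if "x \<in> S" for x v
    using that by (metis frechet_derivative_at)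
  ultimately show ?case
    using Suc.IH[OF Ck_on_Suc_derivative[OF Suc.prems(1)]] by (auto simp: differentiable_def)
qed

text \<open>Lets a derivative computed by hand stand in for \<open>frechet_derivative\<close>:
  uniqueness of the derivative identifies the two on \<open>S\<close>, and \<open>Ck_on_cong\<close>
  transfers the regularity.\<close>

lemma Ck_on_SucI:
  assumes "open S" "\<And>x. x \<in> S \<Longrightarrow> (f has_derivative f' x) (at x)" "\<And>v. Ck_on k S (\<lambda>x. f' x v)"
  shows "Ck_on (Suc k) S f"
proof -
  have "f' x v = frechet_derivative f (at x) v" if "x \<in> S" for x v
    using frechet_derivative_at[OF assms(2)[OF that]] by simp
  then show ?thesis
    using assms(2) by (auto simp: differentiable_def intro: Ck_on_cong[OF assms(1,3)])
qed

lemma Ck_on_subset: "Ck_on k S f \<Longrightarrow> T \<subseteq> S \<Longrightarrow> Ck_on k T f"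
  by (induction k arbitrary: f) (auto intro: continuous_on_subset)

lemma Ck_on_Suc_imp: "Ck_on (Suc k) S f \<Longrightarrow> Ck_on k S f"
proof (induction k arbitrary: f)
  case 0
  then show ?case
    by (simp add: continuous_at_imp_continuous_on differentiable_imp_continuous_within)
next
  case (Suc k)
  then show ?case by (metis Ck_on.simps(2))
qed

lemma Ck_on_const: "Ck_on k S (\<lambda>x. c)"
  by (induction k arbitrary: c) auto

lemma Ck_on_bounded_linear: "bounded_linear f \<Longrightarrow> Ck_on k S f"
proof (cases k)
  case (Suc k)
  assume f: "bounded_linear f"
  then have "frechet_derivative f (at x) = f" for x
    by (metis bounded_linear_imp_has_derivative frechet_derivative_at)
  then show ?thesis
    using Suc f by (auto simp: Ck_on_const bounded_linear_imp_differentiable)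
qed (simp add: linear_continuous_on)

lemma Ck_on_add:
  assumes "open S"
  shows "Ck_on k S f \<Longrightarrow> Ck_on k S g \<Longrightarrow> Ck_on k S (\<lambda>x. f x + g x)"
proof (induction k arbitrary: f g)
  case 0
  then show ?case by (auto intro!: continuous_intros)
next
  case (Suc k)
  show ?case
    by (rule Ck_on_SucI[OF \<open>open S\<close> has_derivative_add[OF Ck_on_Suc_has_derivative Ck_on_Suc_has_derivative]])
      (use Suc in \<open>auto intro: Ck_on_Suc_derivative\<close>)
qed

lemma Ck_on_scaleR:
  assumes "open S"
  shows "Ck_on k S a \<Longrightarrow> Ck_on k S f \<Longrightarrow> Ck_on k S (\<lambda>x. a x *\<^sub>R f x)"
proof (induction k arbitrary: a f)
  case 0
  then show ?case by (auto intro!: continuous_intros)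
next
  case (Suc k)
  show ?case
  proof (rule Ck_on_SucI[OF \<open>open S\<close> has_derivative_scaleR[OF Ck_on_Suc_has_derivative Ck_on_Suc_has_derivative]])
    fix v
    \<comment> \<open>Each Leibniz term has one factor that is not differentiated;
      \<open>Ck_on_Suc_imp\<close> lowers its class to \<open>k\<close> so that the induction
      hypothesis applies.\<close>
    show "Ck_on k S (\<lambda>x. a x *\<^sub>R frechet_derivative f (at x) v + frechet_derivative a (at x) v *\<^sub>R f x)"
      by (rule Ck_on_add[OF \<open>open S\<close> Suc.IH[OF Ck_on_Suc_imp Ck_on_Suc_derivative]
            Suc.IH[OF Ck_on_Suc_derivative Ck_on_Suc_imp]]; rule Suc.prems)
  qed (use Suc.prems in auto)
qed

lemma Ck_on_sum:
  assumes "open S" "\<And>i. i \<in> A \<Longrightarrow> Ck_on k S (f i)"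
  shows "Ck_on k S (\<lambda>x. \<Sum>i\<in>A. f i x)"
  using assms(2)
  by (induction A rule: infinite_finite_induct) (auto simp: Ck_on_const intro: Ck_on_add[OF assms(1)])

lemma Ck_on_linear_image:
  assumes "open S" "bounded_linear L"
  shows "Ck_on k S f \<Longrightarrow> Ck_on k S (\<lambda>x. L (f x))"
proof (induction k arbitrary: f)
  case 0
  then show ?case
    using assms(2) by (auto intro: bounded_linear.continuous_on)
next
  case (Suc k)
  show ?case
    by (rule Ck_on_SucI[OF \<open>open S\<close> bounded_linear.has_derivative[OF assms(2) Ck_on_Suc_has_derivative]])
      (use Suc in \<open>auto intro: Ck_on_Suc_derivative\<close>)
qed

text \<open>Used to trade a direction that depends on the point for finitely many fixed ones, since
  \<open>Ck_on\<close> controls derivatives along fixed vectors.\<close>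

lemma linear_euclidean_expansion:
  fixes v :: "'a::euclidean_space"
  assumes "linear f"
  shows "f v = (\<Sum>b\<in>Basis. (v \<bullet> b) *\<^sub>R f b)"
  using linear_sum[OF assms, of "\<lambda>b. (v \<bullet> b) *\<^sub>R b" Basis] linear_cmul[OF assms]
  by (simp add: euclidean_representation)

text \<open>In the chain rule the direction \<open>?g' x v\<close> moves with \<open>x\<close>. Over
  \<open>Basis\<close> the derivative becomes a sum of products with fixed directions
  \<open>b\<close>; the factors \<open>?f' (g x) b\<close> are again composites with
  \<open>g\<close>, which is why \<open>f\<close> is generalised in the induction.\<close>

lemma Ck_on_compose:
  fixes f :: "'b::euclidean_space \<Rightarrow> 'c::real_normed_vector" and g :: "'a::real_normed_vector \<Rightarrow> 'b"
  assumes "open S" "open T" "g ` S \<subseteq> T"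
  shows "Ck_on k T f \<Longrightarrow> Ck_on k S g \<Longrightarrow> Ck_on k S (\<lambda>x. f (g x))"
proof (induction k arbitrary: f)
  case 0
  then show ?case using assms by (auto intro: continuous_on_compose2)
next
  case (Suc k)
  let ?f' = "\<lambda>y. frechet_derivative f (at y)" and ?g' = "\<lambda>x. frechet_derivative g (at x)"
  have df: "(f has_derivative ?f' (g x)) (at (g x))" if "x \<in> S" for x
    using Suc.prems that assms by (intro Ck_on_Suc_has_derivative) auto
  have der: "((\<lambda>x. f (g x)) has_derivative (\<lambda>v. \<Sum>b\<in>Basis. (?g' x v \<bullet> b) *\<^sub>R ?f' (g x) b)) (at x)"
    if x: "x \<in> S" for x
    by (rule has_derivative_eq_rhs[OF has_derivative_compose[OF Ck_on_Suc_has_derivative[OF Suc.prems(2) x] df[OF x]]])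
      (rule ext, rule linear_euclidean_expansion[OF has_derivative_linear[OF df[OF x]]])
  have f': "Ck_on k S (\<lambda>x. ?f' (g x) b)" for b
    by (rule Suc.IH[OF Ck_on_Suc_derivative[OF Suc.prems(1)] Ck_on_Suc_imp[OF Suc.prems(2)]])
  have g': "Ck_on k S (\<lambda>x. ?g' x v \<bullet> b)" for v b
    by (rule Ck_on_linear_image[OF \<open>open S\<close> bounded_linear_inner_left Ck_on_Suc_derivative[OF Suc.prems(2)]])
  have "Ck_on k S (\<lambda>x. \<Sum>b\<in>Basis. (?g' x v \<bullet> b) *\<^sub>R ?f' (g x) b)" for v
    by (rule Ck_on_sum[OF \<open>open S\<close>]) (rule Ck_on_scaleR[OF \<open>open S\<close> g' f'])
  with der show ?case
    by (rule Ck_on_SucI[OF \<open>open S\<close>])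
qed

section \<open>The corresponding rules for smooth maps, and smoothness of the hyperbolic
  functions\<close>

lemma smooth_on_cong:
  "open S \<Longrightarrow> smooth_on S f \<Longrightarrow> (\<And>x. x \<in> S \<Longrightarrow> f x = g x) \<Longrightarrow> smooth_on S g"
  unfolding smooth_on_def using Ck_on_cong by blast

lemma smooth_on_subset: "smooth_on S f \<Longrightarrow> T \<subseteq> S \<Longrightarrow> smooth_on T f"
  unfolding smooth_on_def using Ck_on_subset by blast

lemma smooth_on_continuous: "smooth_on S f \<Longrightarrow> continuous_on S f"
  unfolding smooth_on_def by (metis Ck_on.simps(1))

lemma smooth_on_has_derivative:
  "smooth_on S f \<Longrightarrow> x \<in> S \<Longrightarrow> (f has_derivative frechet_derivative f (at x)) (at x)"
  unfolding smooth_on_def using Ck_on_Suc_has_derivative by blast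

lemma smooth_on_derivative: "smooth_on S f \<Longrightarrow> smooth_on S (\<lambda>x. frechet_derivative f (at x) v)"
  unfolding smooth_on_def using Ck_on_Suc_derivative by blast

lemma smooth_on_const: "smooth_on S (\<lambda>x. c)"
  unfolding smooth_on_def using Ck_on_const by blast

lemma smooth_on_bounded_linear: "bounded_linear f \<Longrightarrow> smooth_on S f"
  unfolding smooth_on_def using Ck_on_bounded_linear by blast

lemma smooth_on_add:
  "open S \<Longrightarrow> smooth_on S f \<Longrightarrow> smooth_on S g \<Longrightarrow> smooth_on S (\<lambda>x. f x + g x)"
  unfolding smooth_on_def using Ck_on_add by blast

lemma smooth_on_scaleR:
  "open S \<Longrightarrow> smooth_on S a \<Longrightarrow> smooth_on S f \<Longrightarrow> smooth_on S (\<lambda>x. a x *\<^sub>R f x)"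
  unfolding smooth_on_def using Ck_on_scaleR by blast

lemma smooth_on_linear_image:
  "open S \<Longrightarrow> bounded_linear L \<Longrightarrow> smooth_on S f \<Longrightarrow> smooth_on S (\<lambda>x. L (f x))"
  unfolding smooth_on_def using Ck_on_linear_image by blast

lemma smooth_on_compose:
  fixes f :: "'b::euclidean_space \<Rightarrow> 'c::real_normed_vector" and g :: "'a::real_normed_vector \<Rightarrow> 'b"
  shows "open S \<Longrightarrow> open T \<Longrightarrow> g ` S \<subseteq> T \<Longrightarrow> smooth_on T f \<Longrightarrow> smooth_on S g \<Longrightarrow> smooth_on S (\<lambda>x. f (g x))"
  unfolding smooth_on_def using Ck_on_compose[of S T g _ f] by blast

lemma smooth_on_diff:
  "open S \<Longrightarrow> smooth_on S f \<Longrightarrow> smooth_on S g \<Longrightarrow> smooth_on S (\<lambda>x. f x - g x)"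
  using smooth_on_add[of S f "\<lambda>x. - g x"] smooth_on_linear_image[of S uminus g]
  by (simp add: bounded_linear_minus[OF bounded_linear_ident])

text \<open>Each function is the derivative of the other, so the induction carries both at
  once.\<close>

lemma smooth_on_cosh_sinh: "smooth_on UNIV (cosh :: real \<Rightarrow> real)" "smooth_on UNIV (sinh :: real \<Rightarrow> real)"
proof -
  have "Ck_on k UNIV (cosh :: real \<Rightarrow> real) \<and> Ck_on k UNIV (sinh :: real \<Rightarrow> real)" for k
  proof (induction k)
    case 0
    show ?case by (auto intro!: continuous_intros)
  next
    case (Suc k)
    have der: "(cosh has_derivative (\<lambda>v. v *\<^sub>R sinh x)) (at x)"
      "(sinh has_derivative (\<lambda>v. v *\<^sub>R cosh x)) (at x)" for x :: real
      by (auto intro!: derivative_eq_intros)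
    have Ck: "Ck_on k UNIV (\<lambda>x. v *\<^sub>R sinh x :: real)" "Ck_on k UNIV (\<lambda>x. v *\<^sub>R cosh x :: real)" for v :: real
      using Suc by (simp_all only: Ck_on_scaleR[OF open_UNIV Ck_on_const])
    show ?case
      by (intro conjI Ck_on_SucI[OF open_UNIV]) (rule der Ck)+
  qed
  then show "smooth_on UNIV (cosh :: real \<Rightarrow> real)" "smooth_on UNIV (sinh :: real \<Rightarrow> real)"
    unfolding smooth_on_def by blast+
qed

text \<open>The inverse is differentiable because \<open>(q, w) \<mapsto> (q, B q w)\<close> is a differentiable injection with
  invertible derivative.\<close>

lemma smooth_on_inv_linear:
  fixes B :: "'a::euclidean_space \<Rightarrow> 'b::euclidean_space \<Rightarrow> 'b"
  assumes S: "open S" and B: "\<And>w. smooth_on S (\<lambda>q. B q w)"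
    and lin: "\<And>q. q \<in> S \<Longrightarrow> linear (B q)" and bij: "\<And>q. q \<in> S \<Longrightarrow> bij (B q)"
  shows "smooth_on S (\<lambda>q. inv (B q) v)"
proof -
  define D where "D q u w = frechet_derivative (\<lambda>q. B q w) (at q) u" for q u w
  define E where "E q u w = (\<Sum>b\<in>Basis. (w \<bullet> b) *\<^sub>R D q u b)" for q u w
  define \<Phi> where "\<Phi> = (\<lambda>(q, w). (q, B q w))"
  define \<Psi> where "\<Psi> = (\<lambda>(q, w). (q, inv (B q) w))"
  have D: "((\<lambda>q. B q w) has_derivative (\<lambda>u. D q u w)) (at q)" if "q \<in> S" for q w
    unfolding D_def using smooth_on_has_derivative[OF B that] .
  have lin_inv: "linear (inv (B q))" if "q \<in> S" for q
    using lin bij that by (simp add: bij_is_surj bij_is_inj inj_linear_imp_inv_linear)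
  have B_inv: "B q (inv (B q) w) = w" "inv (B q) (B q w) = w" if "q \<in> S" for q w
    using bij that by (auto simp: bij_is_surj bij_is_inj surj_f_inv_f)
  have open': "open (S \<times> (UNIV :: 'b set))"
    using S by (simp add: open_Times)
  have der\<Phi>: "(\<Phi> has_derivative (\<lambda>(u, s). (u, E q u w + B q s))) (at (q, w))" if q: "q \<in> S" for q w
  proof -
    have Dq: "((\<lambda>p. B (fst p) b) has_derivative (\<lambda>p. D q (fst p) b)) (at (q, w))" for b
      using has_derivative_compose[OF has_derivative_fst[OF has_derivative_ident],
          of "\<lambda>q. B q b" "\<lambda>u. D q u b" "(q, w)" UNIV] D[OF q] by simp
    \<comment> \<open>The hypotheses give differentiability in \<open>q\<close> for a fixed vector.
      Writing \<open>B q w\<close> over the basis makes it a sum of products of differentiable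
      functions of the pair \<open>(q, w)\<close>.\<close>
    have "((\<lambda>p. (fst p, \<Sum>b\<in>Basis. (snd p \<bullet> b) *\<^sub>R B (fst p) b)) has_derivative
        (\<lambda>p. (fst p, \<Sum>b\<in>Basis. (w \<bullet> b) *\<^sub>R D q (fst p) b + (snd p \<bullet> b) *\<^sub>R B q b))) (at (q, w))"
      by (auto intro!: derivative_eq_intros Dq)
    also have "(\<lambda>p. (fst p, \<Sum>b\<in>Basis. (w \<bullet> b) *\<^sub>R D q (fst p) b + (snd p \<bullet> b) *\<^sub>R B q b))
        = (\<lambda>(u, s). (u, E q u w + B q s))"
      by (auto simp: E_def sum.distrib linear_euclidean_expansion[OF lin[OF q], symmetric])
    finally show ?thesis
      by (rule has_derivative_transform_within_open[OF _ open'])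
        (use q in \<open>auto simp: \<Phi>_def linear_euclidean_expansion[OF lin, symmetric]\<close>)
  qed
  \<comment> \<open>The classical formula \<open>- inv B \<circ> B' \<circ> inv B\<close> for the
    derivative of an inverse, obtained by restricting \<open>\<Psi>\<close> to the slice with second
    component \<open>v\<close>; the \<open>0\<close> is the derivative of that constant.\<close>
  have der: "((\<lambda>q. inv (B q) v) has_derivative (\<lambda>u. inv (B q) (0 - E q u (inv (B q) v)))) (at q)"
    if q: "q \<in> S" for q v
  proof -
    define w where "w = inv (B q) v"
    \<comment> \<open>The proposed derivative comes from solving \<open>E q u w + B q s = t\<close>
      for \<open>s\<close>.\<close>
    have "(\<Psi> has_derivative (\<lambda>(u, t). (u, inv (B q) (t - E q u w)))) (at (\<Phi> (q, w)))"
    proof (rule has_derivative_inverse_strong[OF open' _ _ _ der\<Phi>[OF q]])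
      show "continuous_on (S \<times> UNIV) \<Phi>"
        using der\<Phi> by (auto intro!: continuous_at_imp_continuous_on has_derivative_continuous)
    qed (use q B_inv in \<open>auto simp: \<Phi>_def \<Psi>_def\<close>)
    moreover have "\<Phi> (q, w) = (q, v)"
      by (simp add: \<Phi>_def w_def B_inv q)
    ultimately have "(\<Psi> has_derivative (\<lambda>(u, t). (u, inv (B q) (t - E q u w)))) (at (q, v))"
      by simp
    from has_derivative_snd[OF has_derivative_compose[OF has_derivative_Pair[OF has_derivative_ident has_derivative_const] this]]
    show ?thesis
      by (simp add: \<Psi>_def w_def)
  qed
  have "Ck_on k S (\<lambda>q. inv (B q) v)" for k v
  \<comment> \<open>The derivative applies \<open>inv (B q)\<close> to a vector that depends on
    \<open>q\<close>. Expanding that vector over the basis leaves \<open>inv (B q) c\<close> with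
    \<open>c\<close> fixed, so the hypothesis is needed for vectors other than
    \<open>v\<close>.\<close>
  proof (induction k arbitrary: v)
    case 0
    then show ?case
      using der by (auto intro!: continuous_at_imp_continuous_on has_derivative_continuous)
  next
    case (Suc k)
    have D': "Ck_on k S (\<lambda>q. D q u b)" for u b
      using smooth_on_derivative[OF B] unfolding D_def smooth_on_def by blast
    have "Ck_on k S (\<lambda>q. 0 - E q u (inv (B q) v))" for u
      unfolding E_def diff_0
      by (rule Ck_on_linear_image[OF S bounded_linear_minus[OF bounded_linear_ident]], rule Ck_on_sum[OF S])
        (rule Ck_on_scaleR[OF S Ck_on_linear_image[OF S bounded_linear_inner_left Suc] D'])
    then have "Ck_on k S (\<lambda>q. \<Sum>c\<in>Basis. ((0 - E q u (inv (B q) v)) \<bullet> c) *\<^sub>R inv (B q) c)" for u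
      by (intro Ck_on_sum[OF S] Ck_on_scaleR[OF S _ Suc] Ck_on_linear_image[OF S bounded_linear_inner_left])
    then have "Ck_on k S (\<lambda>q. inv (B q) (0 - E q u (inv (B q) v)))" for u
      by (rule Ck_on_cong[OF S]) (rule linear_euclidean_expansion[OF lin_inv, symmetric])
    with der show ?case
      by (rule Ck_on_SucI[OF S])
  qed
  then show ?thesis
    unfolding smooth_on_def by blast
qed

subsection \<open>The smooth inverse function theorem\<close>

text \<open>The inverse function theorem gives a differentiable \<open>h\<close> with derivative
  \<open>inv (?F' (h y))\<close>. If \<open>h\<close> is C^k, so is this derivative, being
  \<open>h\<close> followed by the smooth map \<open>\<lambda>x. inv (?F' x) v\<close> for each
  \<open>v\<close>; hence \<open>h\<close> is C^(k+1), and induction yields smoothness.\<close>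

lemma smooth_inverse_function_endo:
  fixes F :: "'a::euclidean_space \<Rightarrow> 'a"
  assumes S: "open S" and F: "smooth_on S F" and x0: "x0 \<in> S" and inj: "inj (frechet_derivative F (at x0))"
  obtains U V h where "open U" "U \<subseteq> S" "x0 \<in> U" "open V" "homeomorphism U V F h" "smooth_on V h"
    "\<And>x. x \<in> U \<Longrightarrow> inj (frechet_derivative F (at x))"
proof -
  let ?F' = "\<lambda>x. frechet_derivative F (at x)"
  \<comment> \<open>\<open>inverse_function_theorem\<close> takes the derivative as a continuous map
    into the bounded linear functions; in finite dimension its continuity can be checked vector by
    vector.\<close>
  define f' where "f' x = Blinfun (?F' x)" for x
  have bl: "bounded_linear (?F' x)" if "x \<in> S" for x
    using smooth_on_has_derivative[OF F that] by (rule has_derivative_bounded_linear)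
  then have f': "blinfun_apply (f' x) = ?F' x" if "x \<in> S" for x
    using that by (simp add: f'_def bounded_linear_Blinfun_apply)
  have der: "(F has_derivative blinfun_apply (f' x)) (at x)" if "x \<in> S" for x
    using smooth_on_has_derivative[OF F that] that by (simp add: f')
  have "continuous_on S (\<lambda>x. blinfun_apply (f' x) i)" for i
    by (rule continuous_on_eq[OF smooth_on_continuous[OF smooth_on_derivative[OF F]]]) (simp add: f')
  then have cont: "continuous_on S f'"
    by (intro continuous_on_blinfun_componentwise)
  have lin: "linear (?F' x)" if "x \<in> S" for x
    using bl[OF that] by (rule bounded_linear.linear)
  have "bounded_linear (inv (?F' x0))"
    using lin[OF x0] inj by (simp add: inj_linear_imp_inv_linear linear_linear)
  then have "Blinfun (inv (?F' x0)) o\<^sub>L f' x0 = id_blinfun"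
    using inj by (intro blinfun_eqI) (simp add: f' x0 bounded_linear_Blinfun_apply)
  from inverse_function_theorem[OF S der cont x0 this]
  obtain U V h h' where UV: "open U" "U \<subseteq> S" "x0 \<in> U" "open V" "homeomorphism U V F h"
    and h: "\<And>y. y \<in> V \<Longrightarrow> (h has_derivative h' y) (at y)"
    and h': "\<And>y. y \<in> V \<Longrightarrow> h' y = inv (f' (h y))" "\<And>y. y \<in> V \<Longrightarrow> bij (f' (h y))"
    by metis
  have hV: "h ` V = U"
    using UV(5) by (simp add: homeomorphism_def)
  have bij: "bij (?F' x)" if x: "x \<in> U" for x
  proof -
    obtain y where "y \<in> V" "x = h y"
      using x hV by auto
    then show ?thesis
      using h'(2) f'[of x] x UV(2) by (metis subsetD)
  qed
  have "Ck_on k V h" for k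
  proof (induction k)
    case 0
    then show ?case
      using UV by (simp add: homeomorphism_def)
  next
    case (Suc k)
    have "smooth_on U (\<lambda>x. inv (?F' x) v)" for v
      using smooth_on_derivative[OF F] lin bij UV
      by (intro smooth_on_inv_linear) (auto intro: smooth_on_subset)
    then have "Ck_on k V (\<lambda>y. inv (?F' (h y)) v)" for v
      using Ck_on_compose[of V U h k, OF _ _ _ _ Suc] UV hV by (auto simp: smooth_on_def)
    moreover have "(h has_derivative inv (?F' (h y))) (at y)" if "y \<in> V" for y
      using h[OF that] h'(1)[OF that] f'[of "h y"] hV UV(2) that by auto
    ultimately show ?case
      using Ck_on_SucI[OF UV(4), of h "\<lambda>y. inv (?F' (h y))"] by blast
  qed
  then show thesis
    using that UV bij by (auto simp: smooth_on_def bij_is_inj)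
qed

text \<open>A linear isomorphism \<open>L\<close> between the two spaces reduces the claim to an
  endomorphism; the target neighbourhood is pulled back along \<open>L\<close>.\<close>

theorem smooth_inverse_function:
  fixes F :: "'a::euclidean_space \<Rightarrow> 'b::euclidean_space"
  assumes dim: "DIM('a) = DIM('b)"
    and S: "open S" and F: "smooth_on S F" and x0: "x0 \<in> S" and inj: "inj (frechet_derivative F (at x0))"
  obtains U V h where "open U" "U \<subseteq> S" "x0 \<in> U" "open V" "homeomorphism U V F h" "smooth_on V h"
    "\<And>x. x \<in> U \<Longrightarrow> inj (frechet_derivative F (at x))"
proof -
  obtain L :: "'b \<Rightarrow> 'a" and K where L: "linear L" "linear K" "\<And>x. K (L x) = x" "\<And>x. L (K x) = x"
    using isomorphisms_UNIV_UNIV[OF dim[symmetric]] by metis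
  have bl: "bounded_linear L" "bounded_linear K"
    using L by (simp_all add: linear_linear)
  have F': "frechet_derivative (\<lambda>x. L (F x)) (at x) = (\<lambda>v. L (frechet_derivative F (at x) v))" if "x \<in> S" for x
    using bounded_linear.has_derivative[OF bl(1) smooth_on_has_derivative[OF F that]]
    by (rule frechet_derivative_at[symmetric])
  have inj_iff: "inj (\<lambda>v. L (frechet_derivative F (at x) v)) \<longleftrightarrow> inj (frechet_derivative F (at x))" for x
    using L(3) by (auto simp: inj_def dest: arg_cong[where f = K])
  obtain U V h where U: "open U" "U \<subseteq> S" "x0 \<in> U" and V: "open V"
    and hom: "homeomorphism U V (\<lambda>x. L (F x)) h" and h: "smooth_on V h"
    and inj': "\<And>x. x \<in> U \<Longrightarrow> inj (frechet_derivative (\<lambda>x. L (F x)) (at x))"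
    using smooth_inverse_function_endo[OF S smooth_on_linear_image[OF S bl(1) F] x0] inj F'[OF x0] inj_iff
    by metis
  have opV: "open (L -` V)"
    using V bl(1) by (simp add: continuous_open_vimage linear_continuous_at)
  have img: "L ` (L -` V) \<subseteq> V"
    by auto
  show thesis
  proof
    show "smooth_on (L -` V) (\<lambda>y. h (L y))"
      by (rule smooth_on_compose[OF opV V img h smooth_on_bounded_linear[OF bl(1)]])
    then have "continuous_on (L -` V) (\<lambda>y. h (L y))"
      by (rule smooth_on_continuous)
    moreover have "continuous_on U F"
      using smooth_on_continuous[OF F] U(2) by (rule continuous_on_subset)
    ultimately show "homeomorphism U (L -` V) F (\<lambda>y. h (L y))"
      using hom L(3,4) by (intro homeomorphismI) (auto simp: homeomorphism_def, metis)
    show "inj (frechet_derivative F (at x))" if "x \<in> U" for x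
      using inj'[OF that] inj_iff[of x] F'[of x] U(2) that by auto
  qed (use U opV in auto)
qed

subsection \<open>Hypersurfaces tangent to a para-complex rotation\<close>

text \<open>\<open>\<iota>\<close> parametrises the slice \<open>q0 + \<iota> x\<close> of starting
  points, and \<open>Q (x, z)\<close> is the parameter of the point reached from there after
  rotating by \<open>z\<close>. It is smooth as the first component of a smooth local inverse
  composed with a smooth map.\<close>

lemma para_rotation_lift:
  fixes F :: "'e::euclidean_space \<Rightarrow> 'v::euclidean_space" and J :: "'v \<Rightarrow> 'v"
    and \<iota> :: "'d::euclidean_space \<Rightarrow> 'e"
  assumes dim: "DIM('v) = DIM('e) + 1"
    and J: "linear J" "\<And>v. J (J v) = v" and \<iota>: "linear \<iota>"
    and S: "open S" and F: "smooth_on S F" and q0: "q0 \<in> S"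
    and inj: "\<And>q. q \<in> S \<Longrightarrow> inj (frechet_derivative F (at q))"
    and transv: "\<And>q. q \<in> S \<Longrightarrow> F q \<notin> range (frechet_derivative F (at q))"
    and tang: "\<And>q. q \<in> S \<Longrightarrow> J (F q) \<in> range (frechet_derivative F (at q))"
  obtains r Q where "r > 0" "smooth_on (ball 0 r \<times> ball 0 r) Q" "Q (0, 0) = q0"
    "Q ` (ball 0 r \<times> ball 0 r) \<subseteq> S" "\<And>x. x \<in> ball 0 r \<Longrightarrow> q0 + \<iota> x \<in> S"
    "\<And>x z. x \<in> ball 0 r \<Longrightarrow> z \<in> ball 0 r \<Longrightarrow>
       F (Q (x, z)) = cosh z *\<^sub>R F (q0 + \<iota> x) - sinh z *\<^sub>R J (F (q0 + \<iota> x))"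
proof -
  let ?F' = "\<lambda>q. frechet_derivative F (at q)"
  define G where "G = (\<lambda>(q, t :: real). t *\<^sub>R F q)"
  define y where "y = (\<lambda>(x, z). cosh z *\<^sub>R F (q0 + \<iota> x) - sinh z *\<^sub>R J (F (q0 + \<iota> x)))"
  have F': "(F has_derivative ?F' q) (at q)" if "q \<in> S" for q
    by (rule smooth_on_has_derivative[OF F that])
  have linF': "linear (?F' q)" if "q \<in> S" for q
    using F'[OF that] by (rule has_derivative_linear)
  have blJ: "bounded_linear J" and bl\<iota>: "bounded_linear \<iota>"
    using J \<iota> by (simp_all add: linear_linear)
  have openSU: "open (S \<times> (UNIV :: real set))"
    using S by (simp add: open_Times)
  have sF: "smooth_on (S \<times> UNIV) (\<lambda>p :: 'e \<times> real. F (fst p))"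
    by (rule smooth_on_compose[OF openSU S _ F smooth_on_bounded_linear[OF bounded_linear_fst]]) auto
  have smoothG: "smooth_on (S \<times> UNIV) G"
    using smooth_on_scaleR[OF openSU smooth_on_bounded_linear[OF bounded_linear_snd] sF]
    by (simp add: G_def case_prod_beta')
  have G': "(G has_derivative (\<lambda>(u, s). t *\<^sub>R ?F' q u + s *\<^sub>R F q)) (at (q, t))" if q: "q \<in> S" for q t
  proof -
    have "((\<lambda>p. F (fst p)) has_derivative (\<lambda>p. ?F' q (fst p))) (at (q, t))"
      using has_derivative_compose[OF has_derivative_fst[OF has_derivative_ident], of F "?F' q" "(q, t)" UNIV]
        F'[OF q] by simp
    from has_derivative_scaleR[OF has_derivative_snd[OF has_derivative_ident] this]
    show ?thesis
      by (simp add: G_def case_prod_beta')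
  qed
  \<comment> \<open>Tangent vectors have no radial part; this is what lets a radial coefficient be
    recognised as zero below.\<close>
  have rangeF: "c *\<^sub>R F q \<in> range (?F' q) \<longleftrightarrow> c = 0" if q: "q \<in> S" for c q
  proof
    assume "c *\<^sub>R F q \<in> range (?F' q)"
    then obtain u where u: "c *\<^sub>R F q = ?F' q u"
      by auto
    show "c = 0"
    proof (rule ccontr)
      assume "c \<noteq> 0"
      then have "F q = ?F' q (inverse c *\<^sub>R u)"
        by (simp add: linear_cmul[OF linF'[OF q]] u[symmetric])
      then show False
        using transv[OF q] by auto
    qed
  next
    assume "c = 0"
    then show "c *\<^sub>R F q \<in> range (?F' q)"
      using linear_0[OF linF'[OF q]] by (metis rangeI scaleR_zero_left)
  qed
  \<comment> \<open>A kernel vector \<open>(u, s)\<close> makes \<open>s *\<^sub>R F q0\<close>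
    tangent, so \<open>s = 0\<close> by transversality, and then \<open>u = 0\<close> because
    \<open>F\<close> is an immersion.\<close>
  have "inj (frechet_derivative G (at (q0, 1)))"
  proof -
    have eq: "frechet_derivative G (at (q0, 1)) = (\<lambda>(u, s). ?F' q0 u + s *\<^sub>R F q0)"
      using frechet_derivative_at[OF G'[OF q0, of 1]] by simp
    have lin: "linear (frechet_derivative G (at (q0, 1)))"
      using G'[OF q0, of 1] by (intro linear_frechet_derivative differentiableI)
    show ?thesis
      unfolding linear_injective_0[OF lin]
    proof safe
      fix u :: 'e and s :: real
      assume "frechet_derivative G (at (q0, 1)) (u, s) = 0"
      then have us: "?F' q0 u + s *\<^sub>R F q0 = 0"
        by (simp add: eq)
      then have "s *\<^sub>R F q0 = ?F' q0 (- u)"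
        by (simp add: linear_neg[OF linF'[OF q0]] add_eq_0_iff)
      then have "s = 0"
        using rangeF[OF q0] by blast
      with us inj[OF q0] show "(u, s) = 0"
        using linear_injective_0[OF linF'[OF q0]] by (simp add: zero_prod_def)
    qed
  qed
  moreover have "DIM('e \<times> real) = DIM('v)"
    by (simp add: dim)
  moreover have "(q0, 1) \<in> S \<times> (UNIV :: real set)"
    using q0 by simp
  ultimately obtain N V h where N: "open N" "N \<subseteq> S \<times> UNIV" "(q0, 1) \<in> N" and V: "open V"
    and hom: "homeomorphism N V G h" and h: "smooth_on V h"
    using smooth_inverse_function[OF _ openSU smoothG] by metis
  \<comment> \<open>Having \<open>(q0 + \<iota> x, 1)\<close> in \<open>N\<close> guarantees that
    \<open>h\<close> returns the radial coordinate \<open>1\<close> at the start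
    \<open>z = 0\<close> of the curve through \<open>x\<close>.\<close>
  define D where "D = {x. (q0 + \<iota> x, 1) \<in> N}"
  have D_S: "q0 + \<iota> x \<in> S" if "x \<in> D" for x
    using that N(2) by (auto simp: D_def)
  have "continuous_on UNIV \<iota>"
    using bl\<iota> by (rule linear_continuous_on)
  then have openD: "open D"
    unfolding D_def using open_vimage[OF N(1), of "\<lambda>x. (q0 + \<iota> x, 1)"]
    by (simp add: vimage_def continuous_intros)
  have openDU: "open (D \<times> (UNIV :: real set))"
    using openD by (simp add: open_Times)
  have "smooth_on (D \<times> UNIV) (\<lambda>p :: 'd \<times> real. q0 + \<iota> (fst p))"
    using bl\<iota> by (intro smooth_on_add[OF openDU] smooth_on_const smooth_on_bounded_linear
        bounded_linear_compose[OF _ bounded_linear_fst])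
  then have sF: "smooth_on (D \<times> UNIV) (\<lambda>p :: 'd \<times> real. F (q0 + \<iota> (fst p)))"
    using D_S by (intro smooth_on_compose[OF openDU S _ F]) auto
  have "smooth_on (D \<times> UNIV) (\<lambda>p. cosh (snd p :: real))" "smooth_on (D \<times> UNIV) (\<lambda>p. sinh (snd p :: real))"
    by (auto intro!: smooth_on_compose[OF openDU open_UNIV _ _ smooth_on_bounded_linear[OF bounded_linear_snd]]
        smooth_on_cosh_sinh)
  then have smooth_y: "smooth_on (D \<times> UNIV) y"
    unfolding y_def case_prod_beta'
    by (intro smooth_on_diff[OF openDU] smooth_on_scaleR[OF openDU] smooth_on_linear_image[OF openDU blJ] sF)
  have y0: "y (x, 0) = G (q0 + \<iota> x, 1)" for x
    by (simp add: y_def G_def)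
  have "open (D \<times> UNIV \<inter> y -` V)"
    by (rule continuous_open_preimage[OF smooth_on_continuous[OF smooth_y] openDU V])
  moreover have D0: "0 \<in> D"
    using N(3) linear_0[OF \<iota>] by (simp add: D_def)
  then have "(0, 0) \<in> D \<times> UNIV \<inter> y -` V"
    using hom N(3) linear_0[OF \<iota>] by (auto simp: y0 homeomorphism_def)
  ultimately obtain A B where AB: "open A" "open B" "0 \<in> A" "0 \<in> B" "A \<times> B \<subseteq> D \<times> UNIV \<inter> y -` V"
    by (elim open_prod_elim) auto
  obtain r1 r2 where r: "r1 > 0" "ball 0 r1 \<subseteq> A" "r2 > 0" "ball 0 r2 \<subseteq> B"
    using AB openE by metis
  \<comment> \<open>One radius serves both factors; the ball in \<open>z\<close> is convex, so a
    function with zero derivative on it is constant.\<close>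
  define r where "r = min r1 r2"
  have "r > 0"
    using r by (simp add: r_def)
  let ?P = "ball (0 :: 'd) r \<times> ball (0 :: real) r"
  have openP: "open ?P"
    by (simp add: open_Times)
  have P: "y p \<in> V" "fst p \<in> D" if "p \<in> ?P" for p
  proof -
    have "p \<in> A \<times> B"
      using r that by (auto simp: r_def)
    then show "y p \<in> V" "fst p \<in> D"
      using AB(5) by auto
  qed
  have smooth_hy: "smooth_on ?P (\<lambda>p. h (y p))"
    by (rule smooth_on_compose[OF openP V _ h smooth_on_subset[OF smooth_y]]) (use P in auto)
  have Ghy: "G (h (y p)) = y p" "h (y p) \<in> N" if "p \<in> ?P" for p
    using hom P[OF that] by (auto simp: homeomorphism_def)
  have T: "snd (h (y (x, z))) = 1" if x: "x \<in> ball 0 r" and z: "z \<in> ball 0 r" for x z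
  proof -
    have "((\<lambda>z. snd (h (y (x, z)))) has_derivative (\<lambda>s. 0)) (at z)" if z: "z \<in> ball 0 r" for z
    proof -
      have xz: "(x, z) \<in> ?P"
        using x z by simp
      \<comment> \<open>\<open>c'\<close> is the velocity of the curve in the coordinates
        \<open>(q, t)\<close>; its second component will be shown to vanish.\<close>
      obtain c' where c': "((\<lambda>z. h (y (x, z))) has_derivative c') (at z)"
        using has_derivative_compose[OF has_derivative_Pair[OF has_derivative_const has_derivative_ident]
            smooth_on_has_derivative[OF smooth_hy xz]] by blast
      obtain q t where qt: "h (y (x, z)) = (q, t)"
        by fastforce
      have q: "q \<in> S"
        using Ghy(2)[OF xz] N(2) qt by auto
      have yqt: "y (x, z) = t *\<^sub>R F q"
        using Ghy(1)[OF xz] qt by (simp add: G_def)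
      have "((\<lambda>z. y (x, z)) has_derivative
          (\<lambda>s. (s * sinh z) *\<^sub>R F (q0 + \<iota> x) - (s * cosh z) *\<^sub>R J (F (q0 + \<iota> x)))) (at z)"
        unfolding y_def prod.case by (auto intro!: derivative_eq_intros simp: mult.commute)
      \<comment> \<open>The \<open>z\<close>-derivative of the rotated point is minus its image
        under \<open>J\<close>. That point is \<open>t *\<^sub>R F q\<close>, so the velocity is a
        multiple of \<open>J (F q)\<close> and hence tangent.\<close>
      also have "(\<lambda>s. (s * sinh z) *\<^sub>R F (q0 + \<iota> x) - (s * cosh z) *\<^sub>R J (F (q0 + \<iota> x)))
          = (\<lambda>s. - (s * t) *\<^sub>R J (F q))"
      proof
        fix s
        have "J (y (x, z)) = cosh z *\<^sub>R J (F (q0 + \<iota> x)) - sinh z *\<^sub>R F (q0 + \<iota> x)"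
          by (simp add: y_def linear_diff[OF J(1)] linear_cmul[OF J(1)] J(2))
        then have "t *\<^sub>R J (F q) = cosh z *\<^sub>R J (F (q0 + \<iota> x)) - sinh z *\<^sub>R F (q0 + \<iota> x)"
          by (simp add: yqt linear_cmul[OF J(1)])
        then have "s *\<^sub>R t *\<^sub>R J (F q) = s *\<^sub>R (cosh z *\<^sub>R J (F (q0 + \<iota> x)) - sinh z *\<^sub>R F (q0 + \<iota> x))"
          by simp
        then show "(s * sinh z) *\<^sub>R F (q0 + \<iota> x) - (s * cosh z) *\<^sub>R J (F (q0 + \<iota> x)) = - (s * t) *\<^sub>R J (F q)"
          by (simp add: scaleR_diff_right)
      qed
      finally have d1: "((\<lambda>z. y (x, z)) has_derivative (\<lambda>s. - (s * t) *\<^sub>R J (F q))) (at z)" .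
      have "((\<lambda>z. G (h (y (x, z)))) has_derivative (\<lambda>s. t *\<^sub>R ?F' q (fst (c' s)) + snd (c' s) *\<^sub>R F q)) (at z)"
        using has_derivative_compose[OF c', of G "\<lambda>(u, s). t *\<^sub>R ?F' q u + s *\<^sub>R F q"] G'[OF q]
        by (simp add: qt case_prod_beta')
      then have "((\<lambda>z. y (x, z)) has_derivative (\<lambda>s. t *\<^sub>R ?F' q (fst (c' s)) + snd (c' s) *\<^sub>R F q)) (at z)"
        by (rule has_derivative_transform_within_open[OF _ open_ball z]) (use Ghy(1) x in auto)
      from has_derivative_unique[OF this d1]
      have eq: "t *\<^sub>R ?F' q (fst (c' s)) + snd (c' s) *\<^sub>R F q = - (s * t) *\<^sub>R J (F q)" for s
        by meson
      obtain u where u: "J (F q) = ?F' q u"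
        using tang[OF q] by auto
      \<comment> \<open>In the two expressions for the velocity every term except
        \<open>snd (c' s) *\<^sub>R F q\<close> is tangent, so this one is tangent as well.\<close>
      have "snd (c' s) = 0" for s
      proof -
        have "snd (c' s) *\<^sub>R F q = ?F' q (- (s * t) *\<^sub>R u - t *\<^sub>R fst (c' s))"
          using eq[of s] u
          by (simp only: linear_diff[OF linF'[OF q]] linear_cmul[OF linF'[OF q]] eq_diff_eq add.commute)
        then show ?thesis
          using rangeF[OF q] by blast
      qed
      with has_derivative_snd[OF c'] show ?thesis
        by simp
    qed
    then obtain c where c: "\<And>z. z \<in> ball 0 r \<Longrightarrow> snd (h (y (x, z))) = c"
      using has_derivative_zero_constant[of "ball 0 r" "\<lambda>z. snd (h (y (x, z)))"]
        has_derivative_at_withinI convex_ball by metis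
    have "h (G (q0 + \<iota> x, 1)) = (q0 + \<iota> x, 1)"
      using hom P(2)[of "(x, 0)"] x \<open>r > 0\<close> by (auto simp: homeomorphism_def D_def)
    then have "snd (h (y (x, 0))) = 1"
      by (simp add: y0)
    then show ?thesis
      using c[of 0] c[OF z] \<open>r > 0\<close> by simp
  qed
  show thesis
  proof (rule that)
    show "r > 0" by fact
    show "smooth_on ?P (\<lambda>p. fst (h (y p)))"
      by (rule smooth_on_linear_image[OF openP bounded_linear_fst smooth_hy])
    show "fst (h (y (0, 0))) = q0"
      using hom N(3) linear_0[OF \<iota>] by (simp add: y0 homeomorphism_def)
    show "(\<lambda>p. fst (h (y p))) ` ?P \<subseteq> S"
      using Ghy(2) N(2) by fastforce
    show "q0 + \<iota> x \<in> S" if "x \<in> ball 0 r" for x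
      using P(2)[of "(x, 0)"] that \<open>r > 0\<close> D_S by simp
    \<comment> \<open>Since \<open>G (q, 1) = F q\<close>, radial coordinate \<open>1\<close> puts
      the rotated point on the hypersurface itself.\<close>
    show "F (fst (h (y (x, z)))) = cosh z *\<^sub>R F (q0 + \<iota> x) - sinh z *\<^sub>R J (F (q0 + \<iota> x))"
      if "x \<in> ball 0 r" "z \<in> ball 0 r" for x z
      using Ghy(1)[of "(x, z)"] T[OF that] that by (simp add: G_def y_def case_prod_beta')
  qed
qed

text \<open>The slice is taken orthogonal to the vector \<open>Z\<close> that \<open>?F' q0\<close>
  sends to \<open>J (F q0)\<close>. Then \<open>Q\<close> has derivative
  \<open>\<iota> a - s *\<^sub>R Z\<close> at the origin; this is injective, so \<open>Q\<close>
  restricts to a diffeomorphism onto a neighbourhood of \<open>q0\<close>.\<close>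

theorem para_rotation_local_form:
  fixes F :: "'e::euclidean_space \<Rightarrow> 'v::euclidean_space" and J :: "'v \<Rightarrow> 'v"
  assumes dim: "DIM('v) = DIM('e) + 1" "DIM('e) = DIM('d) + 1"
    and J: "linear J" "\<And>v. J (J v) = v"
    and S: "open S" and F: "smooth_on S F" and q0: "q0 \<in> S"
    and inj: "\<And>q. q \<in> S \<Longrightarrow> inj (frechet_derivative F (at q))"
    and transv: "\<And>q. q \<in> S \<Longrightarrow> F q \<notin> range (frechet_derivative F (at q))"
    and tang: "\<And>q. q \<in> S \<Longrightarrow> J (F q) \<in> range (frechet_derivative F (at q))"
  obtains U :: "'d::euclidean_space set" and I :: "real set" and g N Q R
  where "open U" "open I" "is_interval I" "immersion_on U g"
    "open N" "N \<subseteq> S" "q0 \<in> N" "homeomorphism (U \<times> I) N Q R" "smooth_on (U \<times> I) Q" "smooth_on N R"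
    "\<And>x z. x \<in> U \<Longrightarrow> z \<in> I \<Longrightarrow> F (Q (x, z)) = cosh z *\<^sub>R J (g x) - sinh z *\<^sub>R g x"
proof -
  let ?F' = "\<lambda>q. frechet_derivative F (at q)"
  have F': "(F has_derivative ?F' q) (at q)" if "q \<in> S" for q
    by (rule smooth_on_has_derivative[OF F that])
  have linF': "linear (?F' q)" if "q \<in> S" for q
    using F'[OF that] by (rule has_derivative_linear)
  have blJ: "bounded_linear J"
    using J by (simp add: linear_linear)
  obtain Z where Z: "J (F q0) = ?F' q0 Z"
    using tang[OF q0] by auto
  \<comment> \<open>Otherwise \<open>F q0 = 0\<close>, because \<open>J\<close> is an involution,
    and the zero vector is tangent, against transversality.\<close>
  have "Z \<noteq> 0"
  proof
    assume "Z = 0"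
    then have "J (F q0) = 0"
      using Z linear_0[OF linF'[OF q0]] by simp
    then have "F q0 = ?F' q0 0"
      using J linear_0[OF J(1)] linear_0[OF linF'[OF q0]] by metis
    then show False
      using transv[OF q0] by auto
  qed
  then have "dim (UNIV :: 'd set) = dim {x. Z \<bullet> x = 0}"
    using dim(2) by (simp add: dim_hyperplane)
  from isometries_subspaces[OF subspace_UNIV subspace_hyperplane this]
  obtain \<iota> :: "'d \<Rightarrow> 'e" and \<iota>' where \<iota>: "linear \<iota>" "range \<iota> = {x. Z \<bullet> x = 0}" "\<And>x. \<iota>' (\<iota> x) = x"
    by (metis UNIV_I)
  have bl\<iota>: "bounded_linear \<iota>"
    using \<iota> by (simp add: linear_linear)
  obtain r Q where r: "r > 0" and Q: "smooth_on (ball 0 r \<times> ball 0 r) Q" "Q (0, 0) = q0"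
      "Q ` (ball 0 r \<times> ball 0 r) \<subseteq> S"
    and S\<iota>: "\<And>x. x \<in> ball 0 r \<Longrightarrow> q0 + \<iota> x \<in> S"
    and FQ: "\<And>x z. x \<in> ball 0 r \<Longrightarrow> z \<in> ball 0 r \<Longrightarrow>
       F (Q (x, z)) = cosh z *\<^sub>R F (q0 + \<iota> x) - sinh z *\<^sub>R J (F (q0 + \<iota> x))"
    using para_rotation_lift[OF dim(1) J \<iota>(1) S F q0 inj transv tang] by metis
  let ?P = "ball (0 :: 'd) r \<times> ball (0 :: real) r"
  have openP: "open ?P"
    by (simp add: open_Times)
  have P0: "(0, 0) \<in> ?P"
    using r by simp
  let ?Q' = "frechet_derivative Q (at (0, 0))"
  have Q': "(Q has_derivative ?Q') (at (0, 0))"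
    by (rule smooth_on_has_derivative[OF Q(1) P0])
  \<comment> \<open>The explicit formula is for \<open>F \<circ> Q\<close>, so \<open>?Q'\<close> is
    computed under the injective map \<open>?F' q0\<close>, which is cancelled afterwards.\<close>
  have "?F' q0 (?Q' (a, s)) = ?F' q0 (\<iota> a - s *\<^sub>R Z)" for a s
  proof -
    have F\<iota>: "((\<lambda>p. F (q0 + \<iota> (fst p))) has_derivative (\<lambda>p. ?F' q0 (\<iota> (fst p)))) (at (0, 0))"
    proof -
      have "((\<lambda>p. q0 + \<iota> (fst p)) has_derivative (\<lambda>p. \<iota> (fst p))) (at (0, 0))"
        by (auto intro!: derivative_eq_intros bounded_linear.has_derivative[OF bl\<iota>])
      from has_derivative_compose[OF this, of F "?F' q0"] F'[OF q0] show ?thesis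
        by (simp add: linear_0[OF \<iota>(1)])
    qed
    have "(cosh has_derivative (\<lambda>s. 0)) (at (0 :: real))" "(sinh has_derivative (\<lambda>s. s)) (at (0 :: real))"
      by (auto intro!: derivative_eq_intros)
    then have cs: "((\<lambda>p :: 'd \<times> real. cosh (snd p)) has_derivative (\<lambda>p. 0)) (at (0, 0))"
      "((\<lambda>p :: 'd \<times> real. sinh (snd p)) has_derivative snd) (at (0, 0))"
      using has_derivative_compose[OF has_derivative_snd[OF has_derivative_ident], of _ _ "(0, 0)"]
      by fastforce+
    have "((\<lambda>p. cosh (snd p) *\<^sub>R F (q0 + \<iota> (fst p)) - sinh (snd p) *\<^sub>R J (F (q0 + \<iota> (fst p))))
        has_derivative (\<lambda>p. ?F' q0 (\<iota> (fst p)) - snd p *\<^sub>R J (F q0))) (at (0, 0))"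
      by (auto intro!: derivative_eq_intros cs F\<iota> bounded_linear.has_derivative[OF blJ F\<iota>]
          simp: linear_0[OF \<iota>(1)])
    then have d1: "((\<lambda>p. F (Q p)) has_derivative (\<lambda>p. ?F' q0 (\<iota> (fst p)) - snd p *\<^sub>R J (F q0))) (at (0, 0))"
      by (rule has_derivative_transform_within_open[OF _ openP P0]) (use FQ in auto)
    have d2: "((\<lambda>p. F (Q p)) has_derivative (\<lambda>p. ?F' q0 (?Q' p))) (at (0, 0))"
      using has_derivative_compose[OF Q', of F "?F' q0"] F'[OF q0] Q(2) by simp
    have "?F' q0 (?Q' (a, s)) = ?F' q0 (\<iota> a) - s *\<^sub>R J (F q0)"
      using fun_cong[OF has_derivative_unique[OF d2 d1], of "(a, s)"] by simp
    then show ?thesis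
      by (simp add: Z linear_diff[OF linF'[OF q0]] linear_cmul[OF linF'[OF q0]])
  qed
  then have Q'_eq: "?Q' (a, s) = \<iota> a - s *\<^sub>R Z" for a s
    using inj[OF q0] by (meson injD)
  have linQ': "linear ?Q'"
    using Q' by (rule has_derivative_linear)
  have "inj ?Q'"
    unfolding linear_injective_0[OF linQ']
  proof safe
    fix a :: 'd and s :: real
    assume "?Q' (a, s) = 0"
    then have eq: "\<iota> a = s *\<^sub>R Z"
      by (simp add: Q'_eq)
    \<comment> \<open>Pairing with \<open>Z\<close> separates the slice direction from the rotation
      direction.\<close>
    moreover have "Z \<bullet> \<iota> a = 0"
      using \<iota>(2) by blast
    ultimately have "s = 0"
      using \<open>Z \<noteq> 0\<close> by simp
    moreover from this have "a = 0"
      using eq \<iota>(3)[of a] \<iota>(3)[of 0] linear_0[OF \<iota>(1)] by simp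
    ultimately show "(a, s) = 0"
      by (simp add: zero_prod_def)
  qed
  moreover have "DIM('d \<times> real) = DIM('e)"
    using dim by simp
  ultimately obtain P' N' R where P': "open P'" "P' \<subseteq> ?P" "(0, 0) \<in> P'" and N': "open N'"
    and hom: "homeomorphism P' N' Q R" and R: "smooth_on N' R"
    using smooth_inverse_function[OF _ openP Q(1) P0] by metis
  obtain U I0 where UI0: "open U" "open I0" "0 \<in> U" "0 \<in> I0" "U \<times> I0 \<subseteq> P'"
    using P' by (elim open_prod_elim) auto
  obtain e where e: "e > 0" "ball 0 e \<subseteq> I0"
    using UI0 openE by metis
  \<comment> \<open>A ball in the line is an interval, and centring it at \<open>0\<close> keeps
    \<open>q0 = Q (0, 0)\<close> in the image.\<close>
  define I where "I = ball (0 :: real) e"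
  have UI: "U \<times> I \<subseteq> P'"
    using UI0(5) e(2) by (auto simp: I_def)
  then have UI_P: "U \<times> I \<subseteq> ?P"
    using P'(2) by blast
  have UI_0: "(0, 0) \<in> U \<times> I"
    using UI0 e by (simp add: I_def)
  have U_r: "x \<in> ball 0 r" if "x \<in> U" for x
    using UI_P UI_0 that by auto
  have openUI: "open (U \<times> I)"
    using UI0 by (simp add: open_Times I_def)
  have sub: "Q ` (U \<times> I) \<subseteq> N'"
    using hom UI by (auto simp: homeomorphism_def)
  have homUI: "homeomorphism (U \<times> I) (Q ` (U \<times> I)) Q R"
    by (rule homeomorphism_of_subsets[OF hom UI sub refl])
  \<comment> \<open>As a preimage under the continuous map \<open>R\<close>, the image of the box is
    open.\<close>
  have "Q ` (U \<times> I) = N' \<inter> R -` (U \<times> I)"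
    using hom UI by (auto simp: homeomorphism_def)
  then have openN: "open (Q ` (U \<times> I))"
    using continuous_open_preimage[OF smooth_on_continuous[OF R] N' openUI] by simp
  have sF\<iota>: "smooth_on U (\<lambda>x. F (q0 + \<iota> x))"
    using S\<iota> U_r
    by (intro smooth_on_compose[OF UI0(1) S _ F] smooth_on_add UI0(1) smooth_on_const
        smooth_on_bounded_linear[OF bl\<iota>]) auto
  show thesis
  proof (rule that)
    show "open U" "open I" "is_interval I"
      using UI0 by (auto simp: I_def is_interval_ball_real)
    show "immersion_on U (\<lambda>x. J (F (q0 + \<iota> x)))"
      unfolding immersion_on_def
    proof
      show "smooth_on U (\<lambda>x. J (F (q0 + \<iota> x)))"
        by (rule smooth_on_linear_image[OF UI0(1) blJ sF\<iota>])
      show "\<forall>x\<in>U. inj (frechet_derivative (\<lambda>x. J (F (q0 + \<iota> x))) (at x))"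
      proof
        fix x assume x: "x \<in> U"
        have "((\<lambda>x. q0 + \<iota> x) has_derivative \<iota>) (at x)"
          by (auto intro!: derivative_eq_intros bounded_linear_imp_has_derivative[OF bl\<iota>])
        from bounded_linear.has_derivative[OF blJ has_derivative_compose[OF this F'[OF S\<iota>[OF U_r[OF x]]]]]
        have "frechet_derivative (\<lambda>x. J (F (q0 + \<iota> x))) (at x) = (\<lambda>v. J (?F' (q0 + \<iota> x) (\<iota> v)))"
          by (rule frechet_derivative_at[symmetric])
        \<comment> \<open>A composite of injective maps: \<open>\<iota>\<close> has a left inverse,
          \<open>F\<close> is an immersion and \<open>J\<close> is an involution.\<close>
        moreover have "inj (\<lambda>v. J (?F' (q0 + \<iota> x) (\<iota> v)))"
          by (rule injI) (metis J(2) \<iota>(3) inj[OF S\<iota>[OF U_r[OF x]]] injD)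
        ultimately show "inj (frechet_derivative (\<lambda>x. J (F (q0 + \<iota> x))) (at x))"
          by simp
      qed
    qed
    show "open (Q ` (U \<times> I))" "homeomorphism (U \<times> I) (Q ` (U \<times> I)) Q R"
      by fact+
    show "Q ` (U \<times> I) \<subseteq> S"
      using Q(3) UI_P by blast
    show "q0 \<in> Q ` (U \<times> I)"
      using Q(2) UI_0 by (metis imageI)
    show "smooth_on (U \<times> I) Q"
      by (rule smooth_on_subset[OF Q(1) UI_P])
    show "smooth_on (Q ` (U \<times> I)) R"
      by (rule smooth_on_subset[OF R sub])
    show "F (Q (x, z)) = cosh z *\<^sub>R J (J (F (q0 + \<iota> x))) - sinh z *\<^sub>R J (F (q0 + \<iota> x))"
      if "x \<in> U" "z \<in> I" for x z
      using FQ[of x z] UI_P that J(2) by auto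
  qed
qed

subsection \<open>Charts\<close>

lemma is_chart_topspace: "is_chart M (U, \<phi>) \<Longrightarrow> topspace (subtopology M U) = U"
  by (auto simp: is_chart_def dest: openin_subset)

lemma is_chart_inj_on:
  assumes "is_chart M (U, \<phi>)"
  shows "inj_on \<phi> U"
proof -
  have "homeomorphic_map (subtopology M U) (top_of_set (\<phi> ` U)) \<phi>"
    using assms by (simp add: is_chart_def)
  from homeomorphic_imp_injective_map[OF this] show ?thesis
    by (simp only: is_chart_topspace[OF assms])
qed

lemma is_chart_open_image:
  assumes "is_chart M (U, \<phi>)" "openin M W"
  shows "open (\<phi> ` (U \<inter> W))"
proof -
  have "openin (subtopology M U) (U \<inter> W)"
    using assms(2) by (simp add: openin_subtopology_Int2)
  then have "openin (top_of_set (\<phi> ` U)) (\<phi> ` (U \<inter> W))"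
    using assms(1) homeomorphic_imp_open_map unfolding is_chart_def open_map_def by blast
  then show ?thesis
    using assms(1) by (auto simp: is_chart_def openin_open_eq)
qed

text \<open>Carries coordinates built inside the image of a chart back to the manifold.\<close>

lemma is_chart_reparam:
  assumes chart: "is_chart M (U, \<phi>)" and B: "open B" and N: "open N" "N \<subseteq> \<phi> ` U"
    and hom: "homeomorphism B N Q R"
  shows "is_chart M ({m \<in> U. \<phi> m \<in> N}, R \<circ> \<phi>)" (is "is_chart M (?W, _)")
    and "(R \<circ> \<phi>) ` {m \<in> U. \<phi> m \<in> N} = B"
proof -
  have U: "openin M U" "topspace (subtopology M U) = U"
    and h: "homeomorphic_map (subtopology M U) (top_of_set (\<phi> ` U)) \<phi>" and opU: "open (\<phi> ` U)"
    using chart is_chart_topspace[OF chart] by (simp_all add: is_chart_def)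
  have img: "\<phi> ` ?W = N"
    using N(2) by auto
  have RN: "R ` N = B"
    using hom by (simp add: homeomorphism_def)
  show surj: "(R \<circ> \<phi>) ` ?W = B"
    by (simp only: image_comp[symmetric] img RN)
  have "openin (top_of_set (\<phi> ` U)) N"
    using N opU by (simp add: openin_open_eq)
  from openin_continuous_map_preimage[OF homeomorphic_imp_continuous_map[OF h] this]
  have "openin (subtopology M U) ?W"
    unfolding U(2) .
  then have W: "openin M ?W"
    using U(1) openin_trans_full by blast
  have "homeomorphic_map (subtopology (subtopology M U) ?W) (subtopology (top_of_set (\<phi> ` U)) N) \<phi>"
    by (rule homeomorphic_map_subtopologies[OF h]) (use U N in auto)
  then have "homeomorphic_map (subtopology M ?W) (top_of_set N) \<phi>"
    using N(2) by (simp add: subtopology_subtopology Int_absorb1 Collect_conj_eq)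
  moreover have "homeomorphic_map (top_of_set N) (top_of_set B) R"
    using hom unfolding homeomorphic_map_maps homeomorphic_maps_def homeomorphism_def
    by (intro exI[of _ Q]) (auto simp: continuous_map_in_subtopology)
  ultimately have "homeomorphic_map (subtopology M ?W) (top_of_set B) (R \<circ> \<phi>)"
    by (rule homeomorphic_map_compose)
  then show "is_chart M (?W, R \<circ> \<phi>)"
    using W B surj unfolding is_chart_def by simp
qed

text \<open>Transition maps to a chart \<open>\<psi>\<close> of the atlas factor through
  \<open>\<phi>\<close>: one is the old transition followed by \<open>R\<close>, the other is
  \<open>Q\<close> followed by the old transition. The second claim lets a map on the manifold be
  read in the new coordinates by composing its expression in \<open>\<phi>\<close> with
  \<open>Q\<close>.\<close>

lemma local_coordinates_reparam:
  assumes atlas: "smooth_atlas M A" and U: "(U, \<phi>) \<in> A"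
    and B: "open B" and N: "open N" "N \<subseteq> \<phi> ` U" and hom: "homeomorphism B N Q R"
    and Q: "smooth_on B Q" and R: "smooth_on N R"
  shows "local_coordinates M A {m \<in> U. \<phi> m \<in> N} (R \<circ> \<phi>)" (is "local_coordinates M A ?W ?\<kappa>")
    and "b \<in> B \<Longrightarrow> inv_into {m \<in> U. \<phi> m \<in> N} (R \<circ> \<phi>) b = inv_into U \<phi> (Q b)"
proof -
  have chart: "is_chart M c" if "c \<in> A" for c
    using atlas that by (simp add: smooth_atlas_def)
  note injU = is_chart_inj_on[OF chart[OF U]]
  note chartW = is_chart_reparam(1)[OF chart[OF U] B N hom]
  note injW = is_chart_inj_on[OF chartW]
  have QR: "Q (R q) = q" if "q \<in> N" for q
    using hom that by (simp add: homeomorphism_def)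
  have inv: "inv_into ?W ?\<kappa> (R (\<phi> m)) = m" if "m \<in> U" "\<phi> m \<in> N" for m
    using inv_into_f_f[OF injW, of m] that by simp
  show "inv_into ?W ?\<kappa> b = inv_into U \<phi> (Q b)" if "b \<in> B"
  proof -
    obtain m where "m \<in> U" "\<phi> m \<in> N" "b = R (\<phi> m)"
      using \<open>b \<in> B\<close> is_chart_reparam(2)[OF chart[OF U] B N hom] by (auto simp: image_def)
    then show ?thesis
      by (simp add: inv QR inv_into_f_f[OF injU])
  qed
  have "compatible (V, \<psi>) (?W, ?\<kappa>)" if V: "(V, \<psi>) \<in> A" for V \<psi>
  proof -
    have comp: "smooth_on (\<psi> ` (V \<inter> U)) (\<phi> \<circ> inv_into V \<psi>)" "smooth_on (\<phi> ` (V \<inter> U)) (\<psi> \<circ> inv_into U \<phi>)"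
      using atlas U V by (force simp: smooth_atlas_def compatible_def)+
    note injV = is_chart_inj_on[OF chart[OF V]]
    have openM: "openin M V" "openin M U" "openin M ?W"
      using chart[OF V] chart[OF U] chartW by (simp_all add: is_chart_def)
    have open1: "open (\<psi> ` (V \<inter> ?W))" "open (?\<kappa> ` (V \<inter> ?W))" "open (\<phi> ` (V \<inter> U))"
      using is_chart_open_image[OF chart[OF V] openM(3)] is_chart_open_image[OF chartW openM(1)]
        is_chart_open_image[OF chart[OF U] openM(1)] by (simp_all add: Int_commute)
    have "smooth_on (\<psi> ` (V \<inter> ?W)) (\<lambda>r. R ((\<phi> \<circ> inv_into V \<psi>) r))"
      by (rule smooth_on_compose[OF open1(1) N(1) _ R smooth_on_subset[OF comp(1)]])
        (auto simp: inv_into_f_f[OF injV])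
    then have "smooth_on (\<psi> ` (V \<inter> ?W)) (?\<kappa> \<circ> inv_into V \<psi>)"
      by (simp add: comp_def)
    moreover have "smooth_on (?\<kappa> ` (V \<inter> ?W)) (\<lambda>b. (\<psi> \<circ> inv_into U \<phi>) (Q b))"
    proof (rule smooth_on_compose[OF open1(2,3) _ comp(2) smooth_on_subset[OF Q]])
      show "Q ` ?\<kappa> ` (V \<inter> ?W) \<subseteq> \<phi> ` (V \<inter> U)"
        by (auto simp: QR)
      show "?\<kappa> ` (V \<inter> ?W) \<subseteq> B"
        using is_chart_reparam(2)[OF chart[OF U] B N hom] by blast
    qed
    then have "smooth_on (?\<kappa> ` (V \<inter> ?W)) (\<psi> \<circ> inv_into ?W ?\<kappa>)"
      by (rule smooth_on_cong[OF open1(2)]) (auto simp: inv QR inv_into_f_f[OF injU])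
    ultimately show ?thesis
      by (simp add: compatible_def)
  qed
  then show "local_coordinates M A ?W ?\<kappa>"
    using chartW by (auto simp: local_coordinates_def)
qed

text \<open>By the chain rule through the transition map, the range from any chart around
  \<open>p\<close> lies in the one from \<open>\<phi>\<close>, which is itself a member of the
  union.\<close>

lemma tangent_image_eq_range:
  assumes atlas: "smooth_atlas M A" and f: "immersion A f" and U: "(U, \<phi>) \<in> A" and p: "p \<in> U"
  shows "tangent_image A f p = range (frechet_derivative (f \<circ> inv_into U \<phi>) (at (\<phi> p)))"
proof -
  have chart: "is_chart M c" if "c \<in> A" for c
    using atlas that by (simp add: smooth_atlas_def)
  note injU = is_chart_inj_on[OF chart[OF U]]
  have "range (frechet_derivative (f \<circ> inv_into V \<psi>) (at (\<psi> p)))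
      \<subseteq> range (frechet_derivative (f \<circ> inv_into U \<phi>) (at (\<phi> p)))"
    if V: "(V, \<psi>) \<in> A" and pV: "p \<in> V" for V \<psi>
  proof -
    let ?F = "f \<circ> inv_into U \<phi>" and ?\<tau> = "\<phi> \<circ> inv_into V \<psi>"
    note injV = is_chart_inj_on[OF chart[OF V]]
    have "smooth_on (\<psi> ` (V \<inter> U)) ?\<tau>"
      using atlas U V by (force simp: smooth_atlas_def compatible_def)
    then have \<tau>: "(?\<tau> has_derivative frechet_derivative ?\<tau> (at (\<psi> p))) (at (\<psi> p))"
      by (rule smooth_on_has_derivative) (use p pV in auto)
    have "smooth_on (\<phi> ` U) ?F"
      using f U by (auto simp: immersion_def immersion_on_def)
    then have "(?F has_derivative frechet_derivative ?F (at (\<phi> p))) (at (\<phi> p))"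
      by (rule smooth_on_has_derivative) (use p in auto)
    then have "((\<lambda>r. ?F (?\<tau> r)) has_derivative
        (\<lambda>v. frechet_derivative ?F (at (\<phi> p)) (frechet_derivative ?\<tau> (at (\<psi> p)) v))) (at (\<psi> p))"
      using has_derivative_compose[OF \<tau>, of ?F] by (simp add: inv_into_f_f[OF injV pV])
    moreover have "open (\<psi> ` (V \<inter> U))"
      using chart[OF U] by (intro is_chart_open_image[OF chart[OF V]]) (simp add: is_chart_def)
    ultimately have "((f \<circ> inv_into V \<psi>) has_derivative
        (\<lambda>v. frechet_derivative ?F (at (\<phi> p)) (frechet_derivative ?\<tau> (at (\<psi> p)) v))) (at (\<psi> p))"
      by (rule has_derivative_transform_within_open)
        (use p pV in \<open>auto simp: inv_into_f_f[OF injV] inv_into_f_f[OF injU]\<close>)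
    from frechet_derivative_at[OF this, symmetric] show ?thesis
      by auto
  qed
  then show ?thesis
    using U p unfolding tangent_image_def by blast
qed

text \<open>Such a \<open>c\<close> lies in \<open>T \<inter> span {c}\<close>, so it is zero and
  its span adds nothing to \<open>T\<close>. This turns a tangent position vector into a
  contradiction of dimensions.\<close>

lemma complement_span_mem:
  fixes T :: "'v::real_vector set"
  assumes "{w + s | w s. w \<in> T \<and> s \<in> span {c}} = UNIV" "T \<inter> span {c} = {0}" "c \<in> T"
  shows "T = UNIV"
proof -
  have "c = 0"
    using assms(2,3) span_base[of c "{c}"] by auto
  then show ?thesis
    using assms(1) by auto
qed

section \<open>The centro-affine hypersurface read in a chart\<close>

lemma bounded_linear_para_J: "bounded_linear (para_J :: (real^'k) \<times> (real^'k) \<Rightarrow> _)"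
  unfolding para_J_def case_prod_beta'
  by (intro bounded_linear_Pair bounded_linear_fst bounded_linear_snd)

theorem theorem4p2:
  fixes n :: nat
    and M :: "'a topology"
    and A :: "('a, real^'m) chart set"
    and f :: "'a \<Rightarrow> (real^'k) \<times> (real^'k)"
  assumes "n \<ge> 1"
    and "CARD('m) = 2 * n + 1" and "CARD('k) = n + 1" and "CARD('d) = 2 * n"
    and "smooth_manifold M A" and "connected_space M" and "orientable M A"
    and "centro_affine M A f"
    and "nondegenerate A f (centro_affine_field f)"
    and "para_J_tangent M A f (centro_affine_field f)"
  shows "\<forall>p\<in>topspace M. \<exists>(U :: (real^'d) set) (I :: real set) (g :: real^'d \<Rightarrow> (real^'k) \<times> (real^'k)).
           open U \<and> open I \<and> is_interval I \<and> immersion_on U g \<and>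
           (\<exists>W (\<kappa> :: 'a \<Rightarrow> (real^'d) \<times> real).
              p \<in> W \<and> local_coordinates M A W \<kappa> \<and> \<kappa> ` W = U \<times> I \<and>
              (\<forall>x\<in>U. \<forall>z\<in>I. f (inv_into W \<kappa> (x, z)) = cosh z *\<^sub>R para_J (g x) - sinh z *\<^sub>R g x))"
proof
  fix p assume p: "p \<in> topspace M"
  have atlas: "smooth_atlas M A" and imm: "immersion A f" and transv: "transversal M A f f"
    using assms(5,8) by (auto simp: smooth_manifold_def centro_affine_def hypersurface_def)
  have "p \<in> (\<Union>(U, \<phi>)\<in>A. U)"
    using atlas p by (simp add: smooth_atlas_def)
  then obtain V \<phi> where V: "(V, \<phi>) \<in> A" "p \<in> V"
    by auto
  have chart: "is_chart M (V, \<phi>)"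
    using atlas V(1) by (auto simp: smooth_atlas_def)
  note injV = is_chart_inj_on[OF chart]
  have VM: "V \<subseteq> topspace M"
    using chart by (simp add: is_chart_def openin_subset)
  let ?F = "f \<circ> inv_into V \<phi>"
  let ?F' = "\<lambda>q. frechet_derivative ?F (at q)"
  have S: "open (\<phi> ` V)"
    using chart by (simp add: is_chart_def)
  have F: "smooth_on (\<phi> ` V) ?F" and inj: "\<And>q. q \<in> \<phi> ` V \<Longrightarrow> inj (?F' q)"
    using imm V(1) by (auto simp: immersion_def immersion_on_def)
  have linF': "linear (?F' q)" if "q \<in> \<phi> ` V" for q
    using smooth_on_has_derivative[OF F that] by (rule has_derivative_linear)
  \<comment> \<open>The three dimensions are \<open>2 * n + 2\<close>, \<open>2 * n + 1\<close> and
    \<open>2 * n\<close>.\<close>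
  have dim: "DIM((real^'k) \<times> (real^'k)) = DIM(real^'m) + 1" "DIM(real^'m) = DIM(real^'d) + 1"
    using assms(2-4) by simp_all
  have F_transv: "?F q \<notin> range (?F' q)" if q: "q \<in> \<phi> ` V" for q
  proof
    assume in_range: "?F q \<in> range (?F' q)"
    obtain m where m: "m \<in> V" "q = \<phi> m"
      using q by auto
    have T: "tangent_image A f m = range (?F' q)"
      using tangent_image_eq_range[OF atlas imm V(1) m(1)] m(2) by simp
    have fm: "?F q = f m"
      using m by (simp add: inv_into_f_f[OF injV])
    have "m \<in> topspace M"
      using m VM by auto
    then have "{w + s | w s. w \<in> range (?F' q) \<and> s \<in> span {f m}} = UNIV"
      "range (?F' q) \<inter> span {f m} = {0}"
      using transv unfolding transversal_def T[symmetric] by simp_all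
    then have "range (?F' q) = UNIV"
      using in_range unfolding fm by (rule complement_span_mem)
    \<comment> \<open>An injective linear map onto the whole space would equate dimensions that
      differ by one.\<close>
    then have "dim (UNIV :: (real^'m) set) = dim (UNIV :: ((real^'k) \<times> (real^'k)) set)"
      using dim_image_eq[OF linF'[OF q], of UNIV] inj[OF q] by simp
    then show False
      using dim(1) by simp
  qed
  have F_tang: "para_J (?F q) \<in> range (?F' q)" if q: "q \<in> \<phi> ` V" for q
  proof -
    obtain m where m: "m \<in> V" "q = \<phi> m"
      using q by auto
    \<comment> \<open>The transversal field is \<open>- f\<close>; negating the preimage vector then
      gives tangency of \<open>para_J\<close> applied to \<open>f\<close>.\<close>
    have "para_J (- f m) \<in> range (?F' q)"
      using assms(10) m VM tangent_image_eq_range[OF atlas imm V(1) m(1)]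
      by (auto simp: para_J_tangent_def centro_affine_field_def)
    then obtain v where "para_J (- f m) = ?F' q v"
      by auto
    then have "para_J (f m) = ?F' q (- v)"
      using linear_neg[OF linF'[OF q], of v]
        linear_neg[OF bounded_linear.linear[OF bounded_linear_para_J], of "f m"]
      by (metis add.inverse_inverse)
    then show ?thesis
      using m by (simp add: inv_into_f_f[OF injV])
  qed
  obtain U :: "(real^'d) set" and I g N Q R
    where UI: "open U" "open I" "is_interval I" "immersion_on U g"
      and N: "open N" "N \<subseteq> \<phi> ` V" "\<phi> p \<in> N"
      and hom: "homeomorphism (U \<times> I) N Q R" "smooth_on (U \<times> I) Q" "smooth_on N R"
      and FQ: "\<And>x z. x \<in> U \<Longrightarrow> z \<in> I \<Longrightarrow> ?F (Q (x, z)) = cosh z *\<^sub>R para_J (g x) - sinh z *\<^sub>R g x"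
    by (rule para_rotation_local_form[where F = ?F and J = para_J and S = "\<phi> ` V" and ?q0.0 = "\<phi> p" and 'd = "real^'d"])
      (use dim bounded_linear_para_J S F V inj F_transv F_tang in
        \<open>auto simp: para_J_def case_prod_beta' dest: bounded_linear.linear\<close>)
  have openUI: "open (U \<times> I)"
    using UI by (simp add: open_Times)
  note reparam = local_coordinates_reparam[OF atlas V(1) openUI N(1,2) hom]
  let ?W = "{m \<in> V. \<phi> m \<in> N}"
  have W: "p \<in> ?W" "(R \<circ> \<phi>) ` ?W = U \<times> I"
    using V(2) N(3) is_chart_reparam(2)[OF chart openUI N(1,2) hom(1)] by auto
  \<comment> \<open>In the new coordinates \<open>f\<close> is \<open>?F \<circ> Q\<close>, to which
    the Euclidean formula applies.\<close>
  have fW: "f (inv_into ?W (R \<circ> \<phi>) (x, z)) = cosh z *\<^sub>R para_J (g x) - sinh z *\<^sub>R g x"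
    if "x \<in> U" "z \<in> I" for x z
    using FQ[OF that] reparam(2)[of "(x, z)"] that by simp
  show "\<exists>(U :: (real^'d) set) (I :: real set) (g :: real^'d \<Rightarrow> (real^'k) \<times> (real^'k)).
           open U \<and> open I \<and> is_interval I \<and> immersion_on U g \<and>
           (\<exists>W (\<kappa> :: 'a \<Rightarrow> (real^'d) \<times> real).
              p \<in> W \<and> local_coordinates M A W \<kappa> \<and> \<kappa> ` W = U \<times> I \<and>
              (\<forall>x\<in>U. \<forall>z\<in>I. f (inv_into W \<kappa> (x, z)) = cosh z *\<^sub>R para_J (g x) - sinh z *\<^sub>R g x))"
    by (intro exI[of _ U] exI[of _ I] exI[of _ g] exI[of _ ?W] exI[of _ "R \<circ> \<phi>"] conjI ballI)
      (use UI W reparam(1) fW in simp_all)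
qed

end
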